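(* Every automatic group (in the sense of Thurston) is graph automatic.
   Context: For a finite alphabet $\Sigma$, let $\Sigma^\star$ be the set of finite strings over $\Sigma$. For strings $w_1,\dots,w_n\in\Sigma^\star$ the convolution $\otimes(w_1,\dots,w_n)$ is the string of length $\max_i|w_i|$ over the alphabet $(\Sigma\cup\{\diamond\})^n$ (with $\diamond\notin\Sigma$) whose $k$-th symbol is $(\sigma_1,\dots,\sigma_n)$, where $\sigma_i$ is the $k$-th symbol of $w_i$ if $k\le|w_i|$ and $\sigma_i=\diamond$ otherwise. A relation $R\subseteq(\Sigma^\star)^n$ is FA recognizable if $\{\otimes(w_1,\dots,w_n)\mid (w_1,\dots,w_n)\in R\}$ is a regular language (recognized by a finite automaton). A group $G$ with a finite generating set $X$ is automatic if: (1) there is a regular language $L\subseteq X^\star$ such that the natural map $w\mapsto\bar w$ (product of letters) from $L$ to $G$ is onto; (2) $\{(u,v)\in L^2\mid\bar u=\bar v\}$ is FA recognizable; (3) for each $x\in X$ the relation $\{(u,v)\in L^2\mid\bar u=\overline{vx}\}$ is FA recognizable. Let $G$ be a group generated by a finite set $X$. Its Cayley graph $\Gamma(G,X)$ is viewed as the structure $(G;(E_x)_{x\in X})$ with $E_x=\{(g,gx)\mid g\in G\}$. The group $G$ is graph automatic with respect to $X$ if there are a finite alphabet $\Sigma$, a regular language $R\subseteq\Sigma^\star$ and a bijection $\nu:R\to G$ such that for each $x\in X$ the relation $\{(u,v)\in R^2\mid \nu(u)x=\nu(v)\}$ is FA recognizable. A finitely generated group is graph automatic if it is graph automatic with respect to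 some finite generating set. *)

theory Defs
  imports "HOL-Algebra.Generated_Groups"
begin

(* States are natural numbers; since automata are finite, this loses no generality. *)
definition regular_language :: "'s set \<Rightarrow> 's list set \<Rightarrow> bool" where
  "regular_language A L \<longleftrightarrow> finite A \<and>
     (\<exists>(Q :: nat set) \<delta> q0 F. finite Q \<and> q0 \<in> Q \<and> F \<subseteq> Q \<and>
        (\<forall>q\<in>Q. \<forall>a\<in>A. \<delta> q a \<in> Q) \<and>
        L = {w \<in> lists A. foldl \<delta> q0 w \<in> F})"

(* An n-tuple of strings is a list of n strings; a letter of the convolution is a list of
   n options, None being the padding symbol. *)
definition convolution :: "'s list list \<Rightarrow> 's option list list" where
  "convolution ws =
     map (\<lambda>k. map (\<lambda>w. if k < length w then Some (w ! k) else None) ws)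
       [0..<foldr max (map length ws) 0]"

definition padded_alphabet :: "nat \<Rightarrow> 's set \<Rightarrow> 's option list set" where
  "padded_alphabet n A = {s. length s = n \<and> set s \<subseteq> insert None (Some ` A)}"

definition FA_recognizable :: "nat \<Rightarrow> 's set \<Rightarrow> 's list list set \<Rightarrow> bool" where
  "FA_recognizable n A R \<longleftrightarrow>
     R \<subseteq> {ws. length ws = n \<and> set ws \<subseteq> lists A} \<and>
     regular_language (padded_alphabet n A) (convolution ` R)"

definition finite_generating_set :: "('a, 'b) monoid_scheme \<Rightarrow> 'a set \<Rightarrow> bool" where
  "finite_generating_set G X \<longleftrightarrow>
     finite X \<and> X \<subseteq> carrier G \<and> generate G X = carrier G"

definition word_value :: "('a, 'b) monoid_scheme \<Rightarrow> 'a list \<Rightarrow> 'a" where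
  "word_value G w = foldr (mult G) w (one G)"

(* Words are positive words in X, so surjectivity of the evaluation map on L forces X to
   generate G even as a monoid (as it does when X is closed under inverses). *)
definition automatic_wrt :: "('a, 'b) monoid_scheme \<Rightarrow> 'a set \<Rightarrow> bool" where
  "automatic_wrt G X \<longleftrightarrow> finite_generating_set G X \<and>
     (\<exists>L. regular_language X L \<and>
        word_value G ` L = carrier G \<and>
        FA_recognizable 2 X {[u, v] | u v. u \<in> L \<and> v \<in> L \<and> word_value G u = word_value G v} \<and>
        (\<forall>x\<in>X. FA_recognizable 2 X
           {[u, v] | u v. u \<in> L \<and> v \<in> L \<and> word_value G u = word_value G (v @ [x])}))"

definition automatic_group :: "('a, 'b) monoid_scheme \<Rightarrow> bool" where
  "automatic_group G \<longleftrightarrow> (\<exists>X. automatic_wrt G X)"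

(* HOL has no quantification over types, so the arbitrary finite alphabet is taken to be a
   finite set of natural numbers; any finite alphabet can be renamed to one of these. *)
definition graph_automatic_wrt :: "('a, 'b) monoid_scheme \<Rightarrow> 'a set \<Rightarrow> bool" where
  "graph_automatic_wrt G X \<longleftrightarrow> finite_generating_set G X \<and>
     (\<exists>(A :: nat set) R \<nu>. finite A \<and> regular_language A R \<and>
        bij_betw \<nu> R (carrier G) \<and>
        (\<forall>x\<in>X. FA_recognizable 2 A
           {[u, v] | u v. u \<in> R \<and> v \<in> R \<and> \<nu> u \<otimes>\<^bsub>G\<^esub> x = \<nu> v}))"

definition graph_automatic_group :: "('a, 'b) monoid_scheme \<Rightarrow> bool" where
  "graph_automatic_group G \<longleftrightarrow> (\<exists>X. graph_automatic_wrt G X)"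

end

theory Submission imports Defs begin

text \<open>
  Among all words of \<open>L\<close> representing a group element keep only the length-lexicographically
  least one. The set \<open>R\<close> of these words is regular: \<open>L - R\<close> is the projection to the first
  coordinate of the pairs \<open>(u, v)\<close> with equal value and \<open>v\<close> below \<open>u\<close>, and this projection
  produces no padding because \<open>v\<close> is never longer than \<open>u\<close>. Evaluation is a bijection from \<open>R\<close>
  onto the group, and the edge relations are restrictions of the multiplier relations. Closure
  properties are obtained from the Myhill--Nerode criterion: a language is regular iff it has
  finitely many left quotients.
\<close>

section \<open>Regular languages by left quotients\<close>

definition left_quotient :: "'s list \<Rightarrow> 's list set \<Rightarrow> 's list set" where
  "left_quotient w L = {v. w @ v \<in> L}"

definition left_quotients :: "'s set \<Rightarrow> 's list set \<Rightarrow> 's list set set" where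
  "left_quotients A L = (\<lambda>w. left_quotient w L) ` lists A"

text \<open>This is the canonical automaton of \<open>L\<close>: its states are the left quotients,
  it starts in \<open>L\<close>, and reading a letter takes the quotient by that letter.\<close>

lemma foldl_left_quotient: "foldl (\<lambda>q a. left_quotient [a] q) L w = left_quotient w L"
  by (induction w rule: rev_induct) (auto simp: left_quotient_def)

lemma foldl_closed:
  assumes "\<forall>q\<in>Q. \<forall>a\<in>A. \<delta> q a \<in> Q" "q \<in> Q" "w \<in> lists A"
  shows "foldl \<delta> q w \<in> Q"
  using assms by (induction w arbitrary: q) auto

text \<open>Transports a run along an injective renaming \<open>f\<close> of the states;
  \<open>inv_into Q f\<close> decodes a name before each step.\<close>

lemma foldl_conjugate:
  assumes "\<forall>q\<in>Q. \<forall>a\<in>A. \<delta> q a \<in> Q" "inj_on f Q" "q \<in> Q" "w \<in> lists A"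
  shows "foldl (\<lambda>n a. f (\<delta> (inv_into Q f n) a)) (f q) w = f (foldl \<delta> q w)"
  using assms by (induction w arbitrary: q) auto

text \<open>The definition of regularity fixes natural numbers as states. Renaming allows states of
  any type, in particular left quotients.\<close>

lemma regular_languageI:
  fixes \<delta> :: "'q \<Rightarrow> 's \<Rightarrow> 'q"
  assumes "finite A" "finite Q" "q0 \<in> Q" "\<forall>q\<in>Q. \<forall>a\<in>A. \<delta> q a \<in> Q"
  shows "regular_language A {w \<in> lists A. foldl \<delta> q0 w \<in> F}"
proof -
  obtain f :: "'q \<Rightarrow> nat" where f: "inj_on f Q"
    using finite_imp_inj_to_nat_seg[OF assms(2)] by blast
  let ?\<delta> = "\<lambda>n a. f (\<delta> (inv_into Q f n) a)"
  \<comment> \<open>Only \<open>F \<inter> Q\<close> is renamed: \<open>F\<close> may contain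
    non-states, and a name produced from one could collide with the name of a state.\<close>
  have "foldl ?\<delta> (f q0) w \<in> f ` (F \<inter> Q) \<longleftrightarrow> foldl \<delta> q0 w \<in> F" if "w \<in> lists A" for w
    using foldl_conjugate[OF assms(4) f assms(3) that] foldl_closed[OF assms(4,3) that] f
    by (auto simp: inj_on_def)
  then have eq: "{w \<in> lists A. foldl \<delta> q0 w \<in> F} =
      {w \<in> lists A. foldl ?\<delta> (f q0) w \<in> f ` (F \<inter> Q)}" by blast
  have "finite (f ` Q)" "f q0 \<in> f ` Q" "f ` (F \<inter> Q) \<subseteq> f ` Q"
    "\<forall>n\<in>f ` Q. \<forall>a\<in>A. ?\<delta> n a \<in> f ` Q"
    using assms f by auto
  with assms(1) show ?thesis
    unfolding regular_language_def eq
    by (intro conjI exI[of _ "f ` Q"] exI[of _ ?\<delta>] exI[of _ "f q0"] exI[of _ "f ` (F \<inter> Q)"])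
      simp_all
qed

text \<open>Forwards, the quotient by a word depends only on the state that the word reaches.
  Backwards, the quotients themselves are the states, and those containing the empty word
  accept.\<close>

lemma regular_language_iff:
  "regular_language A L \<longleftrightarrow> finite A \<and> L \<subseteq> lists A \<and> finite (left_quotients A L)"
proof (intro iffI conjI; (elim conjE)?)
  assume "regular_language A L"
  then obtain Q :: "nat set" and \<delta> q0 F where fin: "finite A" "finite Q" and q0: "q0 \<in> Q"
    and \<delta>: "\<forall>q\<in>Q. \<forall>a\<in>A. \<delta> q a \<in> Q" and L: "L = {w \<in> lists A. foldl \<delta> q0 w \<in> F}"
    unfolding regular_language_def by blast
  show "finite A" by (fact fin)
  show "L \<subseteq> lists A" using L by blast
  have "left_quotient w L \<in> (\<lambda>q. {v \<in> lists A. foldl \<delta> q v \<in> F}) ` Q" if "w \<in> lists A" for w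
    using foldl_closed[OF \<delta> q0 that] that by (auto simp: L left_quotient_def intro!: image_eqI)
  then have "left_quotients A L \<subseteq> (\<lambda>q. {v \<in> lists A. foldl \<delta> q v \<in> F}) ` Q"
    unfolding left_quotients_def by blast
  then show "finite (left_quotients A L)"
    using fin(2) finite_surj by blast
next
  assume fin: "finite A" "finite (left_quotients A L)" and L: "L \<subseteq> lists A"
  have "left_quotient [] L \<in> left_quotients A L"
    unfolding left_quotients_def by blast
  then have L_mem: "L \<in> left_quotients A L"
    by (simp add: left_quotient_def)
  have step: "\<forall>q\<in>left_quotients A L. \<forall>a\<in>A. left_quotient [a] q \<in> left_quotients A L"
  proof (intro ballI)
    fix q a assume "q \<in> left_quotients A L" "a \<in> A"
    then obtain w where "w \<in> lists A" "q = left_quotient w L"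
      unfolding left_quotients_def by blast
    with \<open>a \<in> A\<close> show "left_quotient [a] q \<in> left_quotients A L"
      unfolding left_quotients_def
      by (intro image_eqI[of _ _ "w @ [a]"]) (auto simp: left_quotient_def)
  qed
  have "L = {w \<in> lists A. foldl (\<lambda>q a. left_quotient [a] q) L w \<in> {q. [] \<in> q}}"
    using L unfolding foldl_left_quotient by (auto simp: left_quotient_def)
  then show "regular_language A L"
    using regular_languageI[OF fin L_mem step, of "{q. [] \<in> q}"] by simp
qed

text \<open>Quotients commute with Boolean operations, so each quotient of the result comes from a
  pair of quotients. This replaces the product automaton.\<close>

lemma regular_language_Int:
  assumes "regular_language A L" "regular_language A M"
  shows "regular_language A (L \<inter> M)"
proof -
  have "left_quotient w (L \<inter> M) = left_quotient w L \<inter> left_quotient w M" for w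
    by (auto simp: left_quotient_def)
  then have "left_quotients A (L \<inter> M) \<subseteq> (\<lambda>(p, q). p \<inter> q) ` (left_quotients A L \<times> left_quotients A M)"
    unfolding left_quotients_def by force
  then show ?thesis
    using assms unfolding regular_language_iff
    by (meson finite_SigmaI finite_surj le_infI1)
qed

lemma regular_language_Diff:
  assumes "regular_language A L" "regular_language A M"
  shows "regular_language A (L - M)"
proof -
  have "left_quotient w (L - M) = left_quotient w L - left_quotient w M" for w
    by (auto simp: left_quotient_def)
  then have "left_quotients A (L - M) \<subseteq> (\<lambda>(p, q). p - q) ` (left_quotients A L \<times> left_quotients A M)"
    unfolding left_quotients_def by force
  then show ?thesis
    using assms unfolding regular_language_iff
    by (meson finite_SigmaI finite_surj Diff_subset order_trans)
qed

text \<open>The subset construction in terms of quotients: a quotient of the image is determined by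
  the set of quotients of \<open>L\<close> by the preimages of \<open>w\<close>, and there are
  finitely many such sets.\<close>

lemma regular_language_image:
  assumes "regular_language A L" "finite B" "map h ` L \<subseteq> lists B"
  shows "regular_language B (map h ` L)"
proof -
  have "left_quotient w (map h ` L) =
      (\<Union>q\<in>(\<lambda>z. left_quotient z L) ` {z \<in> lists A. map h z = w}. map h ` q)" for w
  proof -
    have L: "L \<subseteq> lists A" using assms(1) by (simp add: regular_language_iff)
    have "w @ v \<in> map h ` L \<longleftrightarrow> (\<exists>z\<in>lists A. map h z = w \<and> v \<in> map h ` {y. z @ y \<in> L})" for v
    proof
      assume "w @ v \<in> map h ` L"
      then obtain x where "x \<in> L" "map h x = w @ v" by (metis imageE)
      \<comment> \<open>Since \<open>h\<close> acts letter by letter, a preimage of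
        \<open>w @ v\<close> splits where \<open>w\<close> ends.\<close>
      then obtain z y where "z @ y \<in> L" "map h z = w" "map h y = v"
        by (auto simp: map_eq_append_conv)
      moreover from this L have "z \<in> lists A" by auto
      ultimately show "\<exists>z\<in>lists A. map h z = w \<and> v \<in> map h ` {y. z @ y \<in> L}" by blast
    next
      assume "\<exists>z\<in>lists A. map h z = w \<and> v \<in> map h ` {y. z @ y \<in> L}"
      then obtain z y where "z @ y \<in> L" "map h z = w" "map h y = v" by blast
      then show "w @ v \<in> map h ` L" by (metis imageI map_append)
    qed
    then show ?thesis unfolding left_quotient_def by blast
  qed
  moreover have "(\<lambda>z. left_quotient z L) ` {z \<in> lists A. map h z = w} \<in> Pow (left_quotients A L)" for w
    unfolding left_quotients_def by blast
  ultimately have sub: "left_quotients B (map h ` L) \<subseteq>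
      (\<lambda>\<Q>. \<Union>q\<in>\<Q>. map h ` q) ` Pow (left_quotients A L)"
    unfolding left_quotients_def[of B] by (intro image_subsetI) (rule image_eqI)
  have "finite (Pow (left_quotients A L))"
    using assms(1) by (simp add: regular_language_iff)
  then have "finite (left_quotients B (map h ` L))"
    using sub by (rule finite_surj)
  with assms(2,3) show ?thesis
    by (simp add: regular_language_iff)
qed

text \<open>Letting \<open>\<phi>\<close> erase padding symbols recovers the components of a convolution.\<close>

lemma regular_language_vimage:
  assumes "regular_language A L" "finite B" "\<And>b. b \<in> B \<Longrightarrow> \<phi> b \<in> lists A"
  shows "regular_language B {z \<in> lists B. concat (map \<phi> z) \<in> L}"
proof -
  have "concat (map \<phi> w) \<in> lists A" if "w \<in> lists B" for w
    using that assms(3) by (fastforce simp: in_lists_conv_set)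
  \<comment> \<open>The quotient of the inverse image by \<open>w\<close> is the inverse image of
    the quotient of \<open>L\<close> by \<open>concat (map \<phi> w)\<close>.\<close>
  then have "left_quotients B {z \<in> lists B. concat (map \<phi> z) \<in> L} \<subseteq>
      (\<lambda>q. {z \<in> lists B. concat (map \<phi> z) \<in> q}) ` left_quotients A L"
    by (auto simp: left_quotients_def left_quotient_def image_iff)
  then show ?thesis
    using assms unfolding regular_language_iff
    by (auto intro: finite_surj)
qed

section \<open>Closure properties of recognizable relations\<close>

lemma finite_padded_alphabet: "finite A \<Longrightarrow> finite (padded_alphabet n A)"
  unfolding padded_alphabet_def
  using finite_lists_length_eq[of "insert None (Some ` A)" n] by (simp add: conj_commute)

lemma convolution_pair_simps [simp]:
  "convolution [[], []] = []"
  "convolution [a # u, []] = [Some a, None] # convolution [u, []]"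
  "convolution [[], b # v] = [None, Some b] # convolution [[], v]"
  "convolution [a # u, b # v] = [Some a, Some b] # convolution [u, v]"
  by (auto simp: convolution_def upt_conv_Cons max_def simp flip: map_Suc_upt
      simp del: upt_Suc)

text \<open>The cases follow the recursion of \<open>convolution\<close> on pairs: an exhausted word
  stays empty while the other is consumed.\<close>

lemma pair_list_induct [case_names Nil_Nil Cons_Nil Nil_Cons Cons_Cons]:
  assumes "P [] []" "\<And>a u. P u [] \<Longrightarrow> P (a # u) []" "\<And>b v. P [] v \<Longrightarrow> P [] (b # v)"
    "\<And>a u b v. P u v \<Longrightarrow> P (a # u) (b # v)"
  shows "P u v"
  using assms by induction_schema (pat_completeness, lexicographic_order)

text \<open>Each column has two entries, so reversing it exchanges the coordinates; swapping thus
  becomes a letter-to-letter map.\<close>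

lemma convolution_pair_swap: "convolution [v, u] = map rev (convolution [u, v])"
  by (induction u v rule: pair_list_induct) auto

lemma foldr_max_length_map:
  "foldr max (map length (map (map f) ws)) 0 = foldr max (map length ws) (0::nat)"
  by (induction ws) auto

lemma convolution_map:
  "convolution (map (map f) ws) = map (map (map_option f)) (convolution ws)"
  unfolding convolution_def foldr_max_length_map by auto

text \<open>A word of length at most one rather than an option, so that it can serve as
  \<open>\<phi>\<close> in \<open>regular_language_vimage\<close>.\<close>

definition letters_at :: "nat \<Rightarrow> 's option list \<Rightarrow> 's list" where
  "letters_at i s = (case s ! i of None \<Rightarrow> [] | Some a \<Rightarrow> [a])"

lemma concat_letters_at:
  "concat (map (letters_at 0) (convolution [u, v])) = u"
  "concat (map (letters_at (Suc 0)) (convolution [u, v])) = v"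
  by (induction u v rule: pair_list_induct) (auto simp: letters_at_def)

lemma letters_at_padded:
  assumes "s \<in> padded_alphabet n A" "i < n"
  shows "letters_at i s \<in> lists A"
proof -
  have "s ! i \<in> set s" using assms by (simp add: padded_alphabet_def)
  then have "s ! i \<in> insert None (Some ` A)"
    using assms(1) unfolding padded_alphabet_def by blast
  then show ?thesis by (auto simp: letters_at_def)
qed

section \<open>Filtering, swapping and renaming recognizable relations\<close>

lemma FA_recognizable_finite: "FA_recognizable n A S \<Longrightarrow> finite (padded_alphabet n A)"
  by (simp add: FA_recognizable_def regular_language_def)

lemma FA_recognizable_pairD:
  assumes "FA_recognizable 2 A S" "s \<in> S"
  obtains u v where "s = [u, v]" "u \<in> lists A" "v \<in> lists A"
proof -
  have "length s = 2" "set s \<subseteq> lists A"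
    using assms by (auto simp: FA_recognizable_def)
  then show thesis
    using that by (auto simp: length_Suc_conv numeral_2_eq_2)
qed

text \<open>Filtering by \<open>P\<close> becomes intersection with \<open>M\<close>, which has to
  decide \<open>P\<close> only on convolutions of pairs from \<open>S\<close>.\<close>

lemma FA_recognizable_filter:
  assumes S: "FA_recognizable 2 A S" and M: "regular_language (padded_alphabet 2 A) M"
    and iff: "\<And>u v. [u, v] \<in> S \<Longrightarrow> convolution [u, v] \<in> M \<longleftrightarrow> P u v"
  shows "FA_recognizable 2 A {[u, v] | u v. [u, v] \<in> S \<and> P u v}"
proof -
  have "convolution ` {[u, v] | u v. [u, v] \<in> S \<and> P u v} = convolution ` S \<inter> M"
  proof (intro equalityI subsetI)
    fix z assume "z \<in> convolution ` S \<inter> M"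
    then obtain s where s: "s \<in> S" "z = convolution s" "z \<in> M" by blast
    then obtain u v where "s = [u, v]" using FA_recognizable_pairD[OF S] by metis
    with s iff show "z \<in> convolution ` {[u, v] | u v. [u, v] \<in> S \<and> P u v}" by blast
  qed (use iff in auto)
  moreover have "regular_language (padded_alphabet 2 A) (convolution ` S \<inter> M)"
    using S M by (auto simp: FA_recognizable_def intro: regular_language_Int)
  ultimately show ?thesis
    using S unfolding FA_recognizable_def by auto
qed

lemma FA_recognizable_restrict:
  assumes S: "FA_recognizable 2 A S" and R: "regular_language A R"
  shows "FA_recognizable 2 A {[u, v] | u v. [u, v] \<in> S \<and> u \<in> R \<and> v \<in> R}"
proof (rule FA_recognizable_filter[OF S])
  let ?P = "padded_alphabet 2 A"
  \<comment> \<open>\<open>?M i\<close> tests membership of coordinate \<open>i\<close> in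
    \<open>R\<close> after erasing its padding.\<close>
  let ?M = "\<lambda>i. {z \<in> lists ?P. concat (map (letters_at i) z) \<in> R}"
  have M: "regular_language ?P (?M i)" if "i < 2" for i
    by (rule regular_language_vimage[OF R FA_recognizable_finite[OF S]])
      (rule letters_at_padded[OF _ that])
  show "regular_language ?P (?M 0 \<inter> ?M 1)"
    by (rule regular_language_Int[OF M M]) simp_all
  fix u v assume "[u, v] \<in> S"
  then have "convolution [u, v] \<in> lists ?P"
    using S unfolding FA_recognizable_def regular_language_iff by blast
  then show "convolution [u, v] \<in> ?M 0 \<inter> ?M 1 \<longleftrightarrow> u \<in> R \<and> v \<in> R"
    by (auto simp: concat_letters_at)
qed

text \<open>Multiplier relations multiply the second word by the generator, edge relations the
  first; this lemma reconciles them.\<close>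

lemma FA_recognizable_swap:
  assumes "FA_recognizable 2 A S"
  shows "FA_recognizable 2 A {[v, u] | u v. [u, v] \<in> S}"
proof -
  let ?S = "{[v, u] | u v. [u, v] \<in> S}"
  have eq: "convolution ` ?S = map rev ` convolution ` S"
  proof (intro equalityI subsetI)
    fix z assume "z \<in> map rev ` convolution ` S"
    then obtain s where s: "s \<in> S" "z = map rev (convolution s)" by blast
    then obtain u v where uv: "s = [u, v]" using FA_recognizable_pairD[OF assms] by metis
    with s have "z = convolution [v, u]" using convolution_pair_swap by metis
    with s uv show "z \<in> convolution ` ?S" by blast
  next
    fix z assume "z \<in> convolution ` ?S"
    then obtain u v where "[u, v] \<in> S" "z = convolution [v, u]" by blast
    then show "z \<in> map rev ` convolution ` S" using convolution_pair_swap by (metis imageI)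
  qed
  have reg: "regular_language (padded_alphabet 2 A) (convolution ` S)"
    and S: "S \<subseteq> {ws. length ws = 2 \<and> set ws \<subseteq> lists A}"
    using assms by (simp_all add: FA_recognizable_def)
  have "rev ` padded_alphabet 2 A \<subseteq> padded_alphabet 2 A"
    by (auto simp: padded_alphabet_def)
  then have "map rev ` lists (padded_alphabet 2 A) \<subseteq> lists (padded_alphabet 2 A)"
    by (metis lists_image lists_mono)
  moreover have "convolution ` S \<subseteq> lists (padded_alphabet 2 A)"
    using reg by (simp add: regular_language_iff)
  ultimately have "map rev ` convolution ` S \<subseteq> lists (padded_alphabet 2 A)" by blast
  then have "regular_language (padded_alphabet 2 A) (map rev ` convolution ` S)"
    by (rule regular_language_image[OF reg FA_recognizable_finite[OF assms]])
  moreover have "?S \<subseteq> {ws. length ws = 2 \<and> set ws \<subseteq> lists A}"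
    using S by fastforce
  ultimately show ?thesis
    unfolding FA_recognizable_def eq by blast
qed

lemma FA_recognizable_rename:
  assumes S: "FA_recognizable n A S" and A: "finite A"
  shows "FA_recognizable n (f ` A) (map (map f) ` S)"
proof -
  let ?B = "padded_alphabet n (f ` A)"
  have eq: "convolution ` map (map f) ` S = map (map (map_option f)) ` convolution ` S"
    by (simp add: image_image convolution_map)
  have reg: "regular_language (padded_alphabet n A) (convolution ` S)"
    and S': "S \<subseteq> {ws. length ws = n \<and> set ws \<subseteq> lists A}"
    using S by (simp_all add: FA_recognizable_def)
  have "map (map_option f) ` padded_alphabet n A \<subseteq> ?B"
    by (fastforce simp: padded_alphabet_def)
  then have "map (map (map_option f)) ` lists (padded_alphabet n A) \<subseteq> lists ?B"
    by (metis lists_image lists_mono)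
  moreover have "convolution ` S \<subseteq> lists (padded_alphabet n A)"
    using reg by (simp add: regular_language_iff)
  ultimately have "map (map (map_option f)) ` convolution ` S \<subseteq> lists ?B" by blast
  then have "regular_language ?B (map (map (map_option f)) ` convolution ` S)"
    by (rule regular_language_image[OF reg finite_padded_alphabet[OF finite_imageI[OF A]]])
  moreover have "set (map (map f) ws) \<subseteq> lists (f ` A)" if "ws \<in> S" for ws
    unfolding lists_image set_map using that S' by (intro image_mono) blast
  then have "map (map f) ` S \<subseteq> {ws. length ws = n \<and> set ws \<subseteq> lists (f ` A)}"
    using S' by (auto simp del: set_map in_lists_conv_set)
  ultimately show ?thesis
    unfolding FA_recognizable_def eq by blast
qed

text \<open>The length bound is what keeps the first coordinate free of padding.\<close>

lemma regular_language_fst: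
  assumes S: "FA_recognizable 2 A S" and A: "finite A"
    and le: "\<And>u v. [u, v] \<in> S \<Longrightarrow> length v \<le> length u"
  shows "regular_language A {u. \<exists>v. [u, v] \<in> S}"
proof -
  have fst: "map (the \<circ> hd) (convolution [u, v]) = u" if "length v \<le> length u" for u v :: "'a list"
    using that by (induction u v rule: pair_list_induct) auto
  have eq: "map (the \<circ> hd) ` convolution ` S = {u. \<exists>v. [u, v] \<in> S}"
  proof (intro equalityI subsetI)
    fix w assume "w \<in> map (the \<circ> hd) ` convolution ` S"
    then obtain s where s: "s \<in> S" "w = map (the \<circ> hd) (convolution s)" by blast
    then obtain u v where "s = [u, v]" using FA_recognizable_pairD[OF S] by metis
    with s le fst show "w \<in> {u. \<exists>v. [u, v] \<in> S}" by auto
  next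
    fix u assume "u \<in> {u. \<exists>v. [u, v] \<in> S}"
    then obtain v where "[u, v] \<in> S" by blast
    then show "u \<in> map (the \<circ> hd) ` convolution ` S"
      using fst[OF le] by (metis imageI)
  qed
  have "S \<subseteq> {ws. length ws = 2 \<and> set ws \<subseteq> lists A}"
    and reg: "regular_language (padded_alphabet 2 A) (convolution ` S)"
    using S by (simp_all add: FA_recognizable_def)
  then have "{u. \<exists>v. [u, v] \<in> S} \<subseteq> lists A" by fastforce
  then show ?thesis
    using regular_language_image[OF reg A, of "the \<circ> hd"] unfolding eq by blast
qed

text \<open>
  The state is the result of comparing \<open>v\<close> with \<open>u\<close> so far: 0, 1, 2 for equal, below, above.
  Once padding appears, the lengths decide.
\<close>

definition lenlex_step :: "('s \<times> 's) set \<Rightarrow> nat \<Rightarrow> 's option list \<Rightarrow> nat" where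
  "lenlex_step r q s =
     (if s ! 1 = None then 1 else if s ! 0 = None then 2 else if q \<noteq> 0 then q
      else if (the (s ! 1), the (s ! 0)) \<in> r then 1
      else if the (s ! 1) = the (s ! 0) then 0 else 2)"

text \<open>The start state is arbitrary so that the induction can advance by one column. The
  verdict \<open>q\<close> carried so far counts only for words of equal length, as later padding
  overwrites it.\<close>

lemma foldl_lenlex_step:
  assumes "irrefl r" "q \<in> {0, 1, 2}"
  shows "foldl (lenlex_step r) q (convolution [u, v]) = 1 \<longleftrightarrow>
    length v < length u \<or> length v = length u \<and> (if q = 0 then (v, u) \<in> lex r else q = 1)"
  using assms(2)
proof (induction u v arbitrary: q rule: pair_list_induct)
  case (Cons_Nil a u)
  then show ?case by (cases u) (auto simp: lenlex_step_def)
next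
  case (Nil_Cons b v)
  then show ?case by (auto simp: lenlex_step_def)
next
  case (Cons_Cons a u b v)
  then show ?case using \<open>irrefl r\<close> by (auto simp: lenlex_step_def irrefl_def)
qed auto

lemma FA_recognizable_lenlex:
  assumes S: "FA_recognizable 2 A S" and r: "irrefl r"
  shows "FA_recognizable 2 A {[u, v] | u v. [u, v] \<in> S \<and> (v, u) \<in> lenlex r}"
proof (rule FA_recognizable_filter[OF S])
  let ?P = "padded_alphabet 2 A"
  let ?M = "{z \<in> lists ?P. foldl (lenlex_step r) 0 z \<in> {1}}"
  show "regular_language ?P ?M"
    using FA_recognizable_finite[OF S]
    by (rule regular_languageI[where Q = "{0, 1, 2}"]) (auto simp: lenlex_step_def)
  fix u v assume "[u, v] \<in> S"
  then have "convolution [u, v] \<in> lists ?P"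
    using S unfolding FA_recognizable_def regular_language_iff by blast
  then show "convolution [u, v] \<in> ?M \<longleftrightarrow> (v, u) \<in> lenlex r"
    by (auto simp: foldl_lenlex_step[OF r, simplified] lenlex_conv)
qed

section \<open>Unique representatives\<close>

lemma (in group) word_value_closed:
  "w \<in> lists (carrier G) \<Longrightarrow> word_value G w \<in> carrier G"
  by (induction w) (auto simp: word_value_def)

lemma (in group) word_value_snoc:
  assumes "w \<in> lists (carrier G)" "x \<in> carrier G"
  shows "word_value G (w @ [x]) = word_value G w \<otimes> x"
  using assms(1)
proof (induction w)
  case (Cons a w)
  then have "word_value G w \<in> carrier G" by (auto intro: word_value_closed)
  with Cons assms(2) show ?case by (auto simp: word_value_def m_assoc)
qed (use assms(2) in \<open>simp add: word_value_def\<close>)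

text \<open>Ordering the whole type rather than the alphabet lets \<open>wf_lenlex\<close> and
  \<open>total_lenlex\<close> apply directly.\<close>

lemma ex_wf_total: "\<exists>r :: ('a \<times> 'a) set. wf r \<and> total r"
proof -
  obtain r :: "('a \<times> 'a) set" where "well_order_on UNIV r"
    using well_order_on by blast
  \<comment> \<open>A well-order in this sense is reflexive, so its strict part is taken.\<close>
  then have "wf (r - Id)" "total (r - Id)"
    by (auto simp: well_order_on_def linear_order_on_def total_on_def)
  then show ?thesis by blast
qed

text \<open>Totality makes two minimal elements of the same fibre equal, which gives injectivity.
  Well-foundedness gives every nonempty fibre a minimal element, which gives surjectivity.\<close>

lemma bij_betw_minimal:
  assumes wf: "wf r" and total: "total r" and M: "M = {u \<in> L. \<nexists>v. v \<in> L \<and> f v = f u \<and> (v, u) \<in> r}"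
  shows "bij_betw f M (f ` L)"
proof (rule bij_betw_imageI)
  show "inj_on f M"
    using total by (auto simp: M inj_on_def total_on_def) metis
  show "f ` M = f ` L"
  proof (intro equalityI subsetI)
    fix y assume "y \<in> f ` L"
    then obtain u where "u \<in> {u \<in> L. f u = y}" by blast
    from wfE_min[OF wf this] obtain m
      where "m \<in> {u \<in> L. f u = y}" "\<And>v. (v, m) \<in> r \<Longrightarrow> v \<notin> {u \<in> L. f u = y}"
      by metis
    then show "y \<in> f ` M" by (auto simp: M)
  qed (auto simp: M)
qed

lemma (in group) unique_representatives:
  assumes "automatic_wrt G X"
  obtains R where "regular_language X R" "bij_betw (word_value G) R (carrier G)"
    "\<And>x. x \<in> X \<Longrightarrow> FA_recognizable 2 X
      {[u, v] | u v. u \<in> R \<and> v \<in> R \<and> word_value G u \<otimes> x = word_value G v}"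
proof -
  from assms obtain L where L: "regular_language X L" and onto: "word_value G ` L = carrier G"
    and eq: "FA_recognizable 2 X
      {[u, v] | u v. u \<in> L \<and> v \<in> L \<and> word_value G u = word_value G v}" (is "FA_recognizable _ _ ?E")
    and mult: "\<And>x. x \<in> X \<Longrightarrow> FA_recognizable 2 X
      {[u, v] | u v. u \<in> L \<and> v \<in> L \<and> word_value G u = word_value G (v @ [x])}"
    and X: "finite X" "X \<subseteq> carrier G"
    unfolding automatic_wrt_def finite_generating_set_def by blast
  obtain r :: "('a \<times> 'a) set" where r: "wf r" "total r" using ex_wf_total by blast
  then have irrefl: "irrefl r" by (simp add: irrefl_def wf_not_refl)
  define S where "S = {[u, v] | u v. [u, v] \<in> ?E \<and> (v, u) \<in> lenlex r}"
  define R where "R = L - {u. \<exists>v. [u, v] \<in> S}"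
  have "regular_language X {u. \<exists>v. [u, v] \<in> S}"
  proof (rule regular_language_fst)
    show "FA_recognizable 2 X S"
      unfolding S_def by (rule FA_recognizable_lenlex[OF eq irrefl])
  \<comment> \<open>The length bound holds because \<open>lenlex\<close> compares lengths
    first.\<close>
  qed (use X in \<open>auto simp: S_def lenlex_conv\<close>)
  with L have R: "regular_language X R"
    unfolding R_def by (rule regular_language_Diff)
  have "R = {u \<in> L. \<nexists>v. v \<in> L \<and> word_value G v = word_value G u \<and> (v, u) \<in> lenlex r}"
    by (auto simp: R_def S_def)
  from bij_betw_minimal[OF wf_lenlex[OF r(1)] total_lenlex[OF r(2)] this]
  have bij: "bij_betw (word_value G) R (carrier G)"
    unfolding onto .
  have R_lists: "R \<subseteq> lists (carrier G)" and R_sub: "R \<subseteq> L"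
    using R X by (auto simp: regular_language_iff R_def)
  have "FA_recognizable 2 X
      {[u, v] | u v. u \<in> R \<and> v \<in> R \<and> word_value G u \<otimes> x = word_value G v}" if "x \<in> X" for x
  proof -
    have "word_value G u \<otimes> x = word_value G (u @ [x])" if "u \<in> R" for u
      using word_value_snoc[of u x] that \<open>x \<in> X\<close> R_lists X(2) by (metis subsetD)
    \<comment> \<open>The edge relation at \<open>x\<close> is the multiplier relation at
      \<open>x\<close>, with coordinates swapped and both restricted to \<open>R\<close>.\<close>
    then have "{[u, v] | u v. u \<in> R \<and> v \<in> R \<and> word_value G u \<otimes> x = word_value G v} =
        {[u, v] | u v. [u, v] \<in> {[v, u] | u v. [u, v] \<in>
          {[u, v] | u v. u \<in> L \<and> v \<in> L \<and> word_value G u = word_value G (v @ [x])}} \<and>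
          u \<in> R \<and> v \<in> R}"
      using R_sub by auto
    then show ?thesis
      using FA_recognizable_restrict[OF FA_recognizable_swap[OF mult[OF that]] R] by simp
  qed
  with R bij show thesis by (rule that)
qed

section \<open>Passage to an alphabet of natural numbers\<close>

theorem proposition7p3:
  fixes G :: "('a, 'b) monoid_scheme"
  assumes "group G"
    and "automatic_group G"
  shows "graph_automatic_group G"
proof -
  interpret group G by fact
  obtain X where aut: "automatic_wrt G X"
    using assms(2) unfolding automatic_group_def by blast
  then have gen: "finite_generating_set G X" and X: "finite X"
    by (auto simp: automatic_wrt_def finite_generating_set_def)
  from aut obtain R where R: "regular_language X R"
    and bij: "bij_betw (word_value G) R (carrier G)"
    and edge: "\<And>x. x \<in> X \<Longrightarrow> FA_recognizable 2 X
      {[u, v] | u v. u \<in> R \<and> v \<in> R \<and> word_value G u \<otimes>\<^bsub>G\<^esub> x = word_value G v}"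
    by (rule unique_representatives) (rule that)
  \<comment> \<open>Representatives are so far words over \<open>X\<close>, while
    \<open>graph_automatic_wrt\<close> asks for letters in \<open>nat\<close>; \<open>f\<close>
    encodes them.\<close>
  obtain f :: "'a \<Rightarrow> nat" where f: "inj_on f X"
    using finite_imp_inj_to_nat_seg[OF X] by blast
  have R_lists: "R \<subseteq> lists X" using R by (simp add: regular_language_iff)
  \<comment> \<open>\<open>\<nu>\<close> decodes the letters and then evaluates. Decoding inverts
    \<open>map f\<close> only on words over \<open>X\<close>, where \<open>f\<close> is
    injective.\<close>
  define \<nu> where "\<nu> = word_value G \<circ> map (inv_into X f)"
  have inv: "map (inv_into X f) (map f u) = u" if "u \<in> R" for u
  proof -
    have "u \<in> lists X" using that R_lists by blast
    then show ?thesis using f by (induction u) auto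
  qed
  then have \<nu>: "\<nu> (map f u) = word_value G u" if "u \<in> R" for u
    using that by (simp add: \<nu>_def del: map_map)
  have "bij_betw (map (inv_into X f)) (map f ` R) R"
    using inv by (intro bij_betw_byWitness[where f' = "map f"]) (auto simp del: map_map)
  then have "bij_betw \<nu> (map f ` R) (carrier G)"
    unfolding \<nu>_def using bij by (rule bij_betw_trans)
  moreover have "regular_language (f ` X) (map f ` R)"
    using R_lists by (intro regular_language_image[OF R finite_imageI[OF X]]) (simp add: lists_image image_mono)
  moreover have "FA_recognizable 2 (f ` X)
      {[u, v] | u v. u \<in> map f ` R \<and> v \<in> map f ` R \<and> \<nu> u \<otimes>\<^bsub>G\<^esub> x = \<nu> v}" if "x \<in> X" for x
  proof -
    have "{[u, v] | u v. u \<in> map f ` R \<and> v \<in> map f ` R \<and> \<nu> u \<otimes>\<^bsub>G\<^esub> x = \<nu> v} =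
        map (map f) ` {[u, v] | u v. u \<in> R \<and> v \<in> R \<and> word_value G u \<otimes>\<^bsub>G\<^esub> x = word_value G v}"
      (is "?E = map (map f) ` ?E'")
    proof (intro equalityI subsetI)
      fix s assume "s \<in> ?E"
      then obtain u v where "s = [map f u, map f v]" "u \<in> R" "v \<in> R"
        "\<nu> (map f u) \<otimes>\<^bsub>G\<^esub> x = \<nu> (map f v)"
        by blast
      then have "s = map (map f) [u, v]" "[u, v] \<in> ?E'" by (simp_all add: \<nu>)
      then show "s \<in> map (map f) ` ?E'" by (rule image_eqI)
    next
      fix s assume "s \<in> map (map f) ` ?E'"
      then obtain u v where "s = [map f u, map f v]" "u \<in> R" "v \<in> R"
        "word_value G u \<otimes>\<^bsub>G\<^esub> x = word_value G v"
        by auto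
      moreover from this have "\<nu> (map f u) \<otimes>\<^bsub>G\<^esub> x = \<nu> (map f v)" by (simp add: \<nu>)
      ultimately show "s \<in> ?E" by blast
    qed
    then show ?thesis
      using FA_recognizable_rename[OF edge[OF that] X] by simp
  qed
  ultimately have "graph_automatic_wrt G X"
    unfolding graph_automatic_wrt_def
    using gen X by (intro conjI exI[of _ "f ` X"] exI[of _ "map f ` R"] exI[of _ \<nu>]) auto
  then show ?thesis
    unfolding graph_automatic_group_def by blast
qed

end
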